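(* Let $r\ge1$, $b,\kappa\in\mathbb{R}$, and let $(u_0,\rho_0)\in H^s(\mathbb{R})\times H^{s-2r+1}(\mathbb{R})$ with $s>2r+\frac12$. Assume that $m_0=(1-\partial_x^2)^ru_0$ has compact support, contained in the interval $[\beta_{m_0},\gamma_{m_0}]$, and that $\rho_0$ is also compactly supported, with support contained in $[\beta_{\rho_0},\gamma_{\rho_0}]$. Let $T=T(u_0,\rho_0)>0$ be the maximal existence time of the unique classical solution $(u,\rho)$ of the Cauchy problem $$\begin{cases} m_t=-bu_xm-um_x-\kappa\rho\rho_x,\quad m=(1-\partial_x^2)^ru,\\ \rho_t=-u\rho_x-(b-1)u_x\rho,\\ u(0,x)=u_0(x),\ \rho(0,x)=\rho_0(x).\end{cases}$$ Then for any $t\in[0,T)$ the $C^1$ function $x\mapsto m(t,x)$ has compact support.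
   Context: The operator $(1-\partial_x^2)^r$ is the Fourier multiplier with symbol $(1+\xi^2)^r$. The system is the case $\alpha\equiv0$ of the two-component system $m_t=\alpha u_x-bu_xm-um_x-\kappa\rho\rho_x$, $\rho_t=-u\rho_x-(b-1)u_x\rho$. A classical solution is one regular enough for the equations to hold pointwise; in particular $m(t,\cdot)$ and $\rho(t,\cdot)$ are $C^1$ functions of $x$ for each $t\in[0,T)$. *)

theory Defs
  imports "HOL-Analysis.Analysis"
begin

definition square_integrable :: "(real \<Rightarrow> 'a::{banach, second_countable_topology}) \<Rightarrow> bool" where
  "square_integrable f \<longleftrightarrow>
     f \<in> borel_measurable lborel \<and> integrable lborel (\<lambda>x. (norm (f x))\<^sup>2)"

text \<open>The Fourier transform on \<open>L\<^sup>2\<close>, with kernel \<open>exp (- \<i> \<xi> x)\<close>, as the \<open>L\<^sup>2\<close> limit of the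
  transforms of the truncations of \<open>f\<close> to \<open>[-R, R]\<close>. It is a relation because \<open>g\<close> is determined
  only up to a null set; by Plancherel every square integrable \<open>f\<close> has such a \<open>g\<close>. The nonnegative
  integral is used so that an infinite \<open>L\<^sup>2\<close> distance cannot count as 0.\<close>

definition has_fourier :: "(real \<Rightarrow> real) \<Rightarrow> (real \<Rightarrow> complex) \<Rightarrow> bool" where
  "has_fourier f g \<longleftrightarrow> square_integrable f \<and> square_integrable g \<and>
     ((\<lambda>R::real. \<integral>\<^sup>+ \<xi>. ennreal ((cmod (g \<xi> -
          (LINT x:{-R..R}|lborel. cis (- (\<xi> * x)) * complex_of_real (f x))))\<^sup>2) \<partial>lborel)
       \<longlongrightarrow> 0) at_top"

definition fourier :: "(real \<Rightarrow> real) \<Rightarrow> (real \<Rightarrow> complex)" where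
  "fourier f = (SOME g. has_fourier f g)"

text \<open>The space \<open>H\<^sup>s\<close> for \<open>s \<ge> 0\<close>, where it consists of square integrable functions; its elements are
  represented by functions rather than by classes modulo null sets.\<close>

definition sobolev :: "real \<Rightarrow> (real \<Rightarrow> real) set" where
  "sobolev s = {f. \<exists>g. has_fourier f g \<and>
     integrable lborel (\<lambda>\<xi>. (1 + \<xi>\<^sup>2) powr s * (cmod (g \<xi>))\<^sup>2)}"

definition sobolev_norm :: "real \<Rightarrow> (real \<Rightarrow> real) \<Rightarrow> real" where
  "sobolev_norm s f = sqrt (LINT \<xi>|lborel. (1 + \<xi>\<^sup>2) powr s * (cmod (fourier f \<xi>))\<^sup>2)"

definition sobolev_continuous_on :: "real \<Rightarrow> real set \<Rightarrow> (real \<Rightarrow> real \<Rightarrow> real) \<Rightarrow> bool" where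
  "sobolev_continuous_on s I v \<longleftrightarrow> (\<forall>t\<in>I. v t \<in> sobolev s) \<and>
     (\<forall>t\<in>I. ((\<lambda>\<tau>. sobolev_norm s (\<lambda>x. v \<tau> x - v t x)) \<longlongrightarrow> 0) (at t within I))"

text \<open>\<open>is_fourier_multiplier a f h\<close>: the function \<open>h\<close> represents the image of \<open>f\<close> under the Fourier
  multiplier with symbol \<open>a\<close>.\<close>

definition is_fourier_multiplier ::
    "(real \<Rightarrow> real) \<Rightarrow> (real \<Rightarrow> real) \<Rightarrow> (real \<Rightarrow> real) \<Rightarrow> bool" where
  "is_fourier_multiplier a f h \<longleftrightarrow> (\<exists>g k. has_fourier f g \<and> has_fourier h k \<and>
     (AE \<xi> in lborel. k \<xi> = complex_of_real (a \<xi>) * g \<xi>))"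

text \<open>\<open>is_inertia r u m\<close>: \<open>m = (1 - \<partial>\<^sub>x\<^sup>2)\<^sup>r u\<close>, up to a null set.\<close>

definition is_inertia :: "real \<Rightarrow> (real \<Rightarrow> real) \<Rightarrow> (real \<Rightarrow> real) \<Rightarrow> bool" where
  "is_inertia r u m \<longleftrightarrow> is_fourier_multiplier (\<lambda>\<xi>. (1 + \<xi>\<^sup>2) powr r) u m"

definition support :: "(real \<Rightarrow> real) \<Rightarrow> real set" where
  "support f = closure (support_on UNIV f)"

definition time_interval :: "ereal \<Rightarrow> real set" where
  "time_interval T = {t. 0 \<le> t \<and> ereal t < T}"

text \<open>Time is the first argument, space the second. Classical regularity means that all derivatives
  occurring in the equations exist and are jointly continuous on \<open>[0, T) \<times> \<real>\<close>, one-sided in time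
  at \<open>t = 0\<close>; in particular \<open>m\<close> and \<open>\<rho>\<close> are \<open>C\<^sup>1\<close> on \<open>[0, T) \<times> \<real>\<close>. As \<open>m t\<close> is continuous,
  \<open>is_inertia\<close> determines it pointwise from \<open>u t\<close>.\<close>

definition classical_solution ::
  "real \<Rightarrow> real \<Rightarrow> real \<Rightarrow> real \<Rightarrow> (real \<Rightarrow> real) \<Rightarrow> (real \<Rightarrow> real) \<Rightarrow> ereal \<Rightarrow>
   (real \<Rightarrow> real \<Rightarrow> real) \<Rightarrow> (real \<Rightarrow> real \<Rightarrow> real) \<Rightarrow> (real \<Rightarrow> real \<Rightarrow> real) \<Rightarrow> bool" where
  "classical_solution r b \<kappa> s u0 \<rho>0 T u m \<rho> \<longleftrightarrow>
     sobolev_continuous_on s (time_interval T) u \<and>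
     sobolev_continuous_on (s - 2 * r + 1) (time_interval T) \<rho> \<and>
     (\<forall>t\<in>time_interval T. is_inertia r (u t) (m t)) \<and>
     (\<forall>x. u 0 x = u0 x \<and> \<rho> 0 x = \<rho>0 x) \<and>
     (\<exists>u\<^sub>x m\<^sub>t m\<^sub>x \<rho>\<^sub>t \<rho>\<^sub>x :: real \<Rightarrow> real \<Rightarrow> real.
        (\<forall>w\<in>{u, u\<^sub>x, m, m\<^sub>t, m\<^sub>x, \<rho>, \<rho>\<^sub>t, \<rho>\<^sub>x}.
           continuous_on (time_interval T \<times> UNIV) (\<lambda>(t, x). w t x)) \<and>
        (\<forall>t\<in>time_interval T. \<forall>x.
           (u t has_real_derivative u\<^sub>x t x) (at x) \<and>
           (m t has_real_derivative m\<^sub>x t x) (at x) \<and>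
           (\<rho> t has_real_derivative \<rho>\<^sub>x t x) (at x) \<and>
           ((\<lambda>\<tau>. m \<tau> x) has_real_derivative m\<^sub>t t x) (at t within time_interval T) \<and>
           ((\<lambda>\<tau>. \<rho> \<tau> x) has_real_derivative \<rho>\<^sub>t t x) (at t within time_interval T) \<and>
           m\<^sub>t t x = - b * u\<^sub>x t x * m t x - u t x * m\<^sub>x t x - \<kappa> * \<rho> t x * \<rho>\<^sub>x t x \<and>
           \<rho>\<^sub>t t x = - u t x * \<rho>\<^sub>x t x - (b - 1) * u\<^sub>x t x * \<rho> t x))"

text \<open>\<open>T\<close> is the maximal existence time (possibly \<open>\<infinity>\<close>) and \<open>(u, \<rho>)\<close> the unique classical solution
  on \<open>[0, T)\<close>: every classical solution with the same data is a restriction of it.\<close>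

definition maximal_classical_solution ::
  "real \<Rightarrow> real \<Rightarrow> real \<Rightarrow> real \<Rightarrow> (real \<Rightarrow> real) \<Rightarrow> (real \<Rightarrow> real) \<Rightarrow> ereal \<Rightarrow>
   (real \<Rightarrow> real \<Rightarrow> real) \<Rightarrow> (real \<Rightarrow> real \<Rightarrow> real) \<Rightarrow> (real \<Rightarrow> real \<Rightarrow> real) \<Rightarrow> bool" where
  "maximal_classical_solution r b \<kappa> s u0 \<rho>0 T u m \<rho> \<longleftrightarrow>
     0 < T \<and> classical_solution r b \<kappa> s u0 \<rho>0 T u m \<rho> \<and>
     (\<forall>T' u' m' \<rho>'. 0 < T' \<longrightarrow> classical_solution r b \<kappa> s u0 \<rho>0 T' u' m' \<rho>' \<longrightarrow>
        T' \<le> T \<and> (\<forall>t\<in>time_interval T'. u' t = u t \<and> \<rho>' t = \<rho> t))"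

end

theory Submission
  imports Defs "HOL-Probability.Probability"
begin

text \<open>On \<open>[0, \<tau>]\<close> the velocity \<open>u\<close> is bounded by some \<open>M\<close>, because \<open>H\<^sup>s\<close> embeds into \<open>L\<^sup>\<infinity>\<close> and \<open>u\<close> is
  continuous in time with values in \<open>H\<^sup>s\<close>. Both \<open>\<rho>\<close> and, wherever \<open>\<rho>\<close> vanishes, \<open>m\<close> solve a linear
  homogeneous transport equation with velocity \<open>u\<close>; a maximum principle on trapezoids whose sides move
  inwards with speed \<open>M\<close> shows that the supports spread with speed at most \<open>M\<close>. This replaces the flow of
  \<open>u\<close>. The Sobolev embedding and the identity \<open>m 0 = m0\<close> (which holds a priori only almost everywhere)
  come from one inequality, \<open>\<bar>f x\<bar> \<le> \<integral>\<bar>g\<bar> / (2 * pi)\<close> for the Fourier transform \<open>g\<close> of \<open>f\<close>, obtained by testing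
  \<open>f\<close> against Gaussians that concentrate at \<open>x\<close>.\<close>

subsection \<open>The Fourier transform on \<open>L\<^sup>2\<close>\<close>

definition trunc_fourier :: "(real \<Rightarrow> real) \<Rightarrow> real \<Rightarrow> real \<Rightarrow> complex" where
  "trunc_fourier f R \<xi> = (LINT x:{-R..R}|lborel. cis (- (\<xi> * x)) * complex_of_real (f x))"

lemma square_integrable_measurable:
  "square_integrable f \<Longrightarrow> f \<in> borel_measurable borel"
  by (simp add: square_integrable_def)

lemma borel_measurable_cis [measurable]: "cis \<in> borel_measurable borel"
  by (intro borel_measurable_continuous_onI continuous_intros)

lemma trunc_fourier_measurable [measurable]:
  assumes [measurable]: "f \<in> borel_measurable borel"
  shows "trunc_fourier f R \<in> borel_measurable borel"
  unfolding trunc_fourier_def set_lebesgue_integral_def by measurable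

text \<open>Follows from \<open>(p * z - 1)\<^sup>2 + p * z \<ge> 0\<close>. The free weight is
  taken as 1 for integrability, as a large \<open>q\<close> in the Gaussian estimate and as
  \<open>1 + \<xi>\<^sup>2\<close> in the Sobolev embedding.\<close>

lemma abs_le_weighted_square:
  fixes p y :: real
  assumes "p > 0"
  shows "\<bar>y\<bar> \<le> 1 / p + p * y\<^sup>2"
proof -
  define z where "z = \<bar>y\<bar>"
  have "y\<^sup>2 = z\<^sup>2" by (simp add: z_def)
  have "0 \<le> (p * z - 1)\<^sup>2 + p * z" using assms by (simp add: z_def)
  then have "z * p \<le> 1 + p * z\<^sup>2 * p" by (simp add: power2_eq_square algebra_simps)
  then have "\<bar>y\<bar> * p \<le> 1 + p * y\<^sup>2 * p" by (simp add: \<open>y\<^sup>2 = z\<^sup>2\<close> flip: z_def)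
  then have "\<bar>y\<bar> \<le> (1 + p * y\<^sup>2 * p) / p" using assms by (simp add: pos_le_divide_eq)
  then show ?thesis using assms by (simp add: add_divide_distrib)
qed

lemma norm_diff_square_le:
  fixes a b :: "'a::real_normed_vector"
  shows "(norm (a - b))\<^sup>2 \<le> 2 * ((norm a)\<^sup>2 + (norm b)\<^sup>2)"
proof -
  have "(norm (a - b))\<^sup>2 \<le> (norm a + norm b)\<^sup>2"
    by (intro power_mono norm_triangle_ineq4) auto
  also have "\<dots> \<le> 2 * ((norm a)\<^sup>2 + (norm b)\<^sup>2)"
    using sum_squares_bound[of "norm a" "norm b"] by (simp add: power2_sum)
  finally show ?thesis .
qed

text \<open>Stated with the nonnegative integral, so that it applies to truncated transforms without
  knowing them to be square integrable.\<close>

lemma nn_integral_cmod_diff_square: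
  fixes p q :: "real \<Rightarrow> complex"
  assumes [measurable]: "p \<in> borel_measurable borel" "q \<in> borel_measurable borel"
  shows "(\<integral>\<^sup>+ x. ennreal ((cmod (p x - q x))\<^sup>2) \<partial>lborel) \<le>
    2 * ((\<integral>\<^sup>+ x. ennreal ((cmod (p x))\<^sup>2) \<partial>lborel) + (\<integral>\<^sup>+ x. ennreal ((cmod (q x))\<^sup>2) \<partial>lborel))"
proof -
  have "(\<integral>\<^sup>+ x. ennreal ((cmod (p x - q x))\<^sup>2) \<partial>lborel) \<le>
      (\<integral>\<^sup>+ x. 2 * (ennreal ((cmod (p x))\<^sup>2) + ennreal ((cmod (q x))\<^sup>2)) \<partial>lborel)"
    using norm_diff_square_le[where 'a = complex]
    by (intro nn_integral_mono)
       (simp add: ennreal_plus[symmetric] ennreal_mult''[symmetric] ennreal_numeral[symmetric] ennreal_leI del: ennreal_plus ennreal_numeral)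
  then show ?thesis by (simp add: nn_integral_cmult nn_integral_add)
qed

lemma square_integrable_diff:
  fixes p q :: "real \<Rightarrow> 'a::{banach, second_countable_topology}"
  assumes "square_integrable p" "square_integrable q"
  shows "square_integrable (\<lambda>x. p x - q x)"
proof -
  have [measurable]: "p \<in> borel_measurable borel" "q \<in> borel_measurable borel"
    using assms by (auto simp: square_integrable_def)
  have "integrable lborel (\<lambda>x. (norm (p x - q x))\<^sup>2)"
  proof (rule Bochner_Integration.integrable_bound)
    show "integrable lborel (\<lambda>x. 2 * ((norm (p x))\<^sup>2 + (norm (q x))\<^sup>2))"
      using assms by (auto simp: square_integrable_def)
    show "AE x in lborel. norm ((norm (p x - q x))\<^sup>2) \<le> norm (2 * ((norm (p x))\<^sup>2 + (norm (q x))\<^sup>2))"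
      using norm_diff_square_le[where 'a = 'a] by simp
  qed measurable
  then show ?thesis by (simp add: square_integrable_def)
qed

lemma square_integrable_set_integrable:
  fixes f :: "real \<Rightarrow> 'a::{banach, second_countable_topology}"
  assumes "square_integrable f"
  shows "set_integrable lborel {a..b} f"
  unfolding set_integrable_def
proof (rule Bochner_Integration.integrable_bound)
  show "integrable lborel (\<lambda>x. indicator {a..b} x + (norm (f x))\<^sup>2 :: real)"
    using assms unfolding square_integrable_def
    by (intro Bochner_Integration.integrable_add integrable_real_indicator)
       (auto simp: emeasure_lborel_Icc_eq)
  show "(\<lambda>x. indicat_real {a..b} x *\<^sub>R f x) \<in> borel_measurable lborel"
    using assms by (auto simp: square_integrable_def)
  have "norm y \<le> 1 + (norm y)\<^sup>2" for y :: 'a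
    using abs_le_weighted_square[of 1 "norm y"] by simp
  then show "AE x in lborel. norm (indicat_real {a..b} x *\<^sub>R f x) \<le> norm (indicator {a..b} x + (norm (f x))\<^sup>2 :: real)"
    by (intro AE_I2) (auto simp: indicator_def)
qed

lemma set_integrable_cis_mult:
  assumes "set_integrable lborel S f"
  shows "set_integrable lborel S (\<lambda>x. cis (\<xi> * x) * complex_of_real (f x))"
proof -
  have [measurable]: "(\<lambda>x. indicat_real S x *\<^sub>R f x) \<in> borel_measurable borel"
    using assms by (auto simp: set_integrable_def dest: borel_measurable_integrable)
  have eq: "(\<lambda>x. indicat_real S x *\<^sub>R (cis (\<xi> * x) * complex_of_real (f x))) =
      (\<lambda>x. cis (\<xi> * x) * complex_of_real (indicat_real S x *\<^sub>R f x))"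
    by (auto simp: scaleR_conv_of_real)
  show ?thesis
    unfolding set_integrable_def eq
  proof (rule Bochner_Integration.integrable_bound[OF assms[unfolded set_integrable_def]])
    show "(\<lambda>x. cis (\<xi> * x) * complex_of_real (indicat_real S x *\<^sub>R f x)) \<in> borel_measurable lborel"
      by measurable
  qed (simp add: norm_mult)
qed

lemma has_fourier_trunc:
  "has_fourier f g \<longleftrightarrow> square_integrable f \<and> square_integrable g \<and>
    ((\<lambda>R. \<integral>\<^sup>+ \<xi>. ennreal ((cmod (g \<xi> - trunc_fourier f R \<xi>))\<^sup>2) \<partial>lborel) \<longlongrightarrow> 0) at_top"
  by (simp add: has_fourier_def trunc_fourier_def)

text \<open>Truncated transforms are linear because square integrable functions are integrable on
  bounded intervals; the squared errors then add up, with a factor 2.\<close>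

lemma has_fourier_diff:
  assumes "has_fourier f1 g1" "has_fourier f2 g2"
  shows "has_fourier (\<lambda>x. f1 x - f2 x) (\<lambda>\<xi>. g1 \<xi> - g2 \<xi>)"
proof -
  have sq: "square_integrable f1" "square_integrable f2" "square_integrable g1" "square_integrable g2"
    using assms by (auto simp: has_fourier_def)
  note [measurable] = sq[THEN square_integrable_measurable]
  have trunc: "trunc_fourier (\<lambda>x. f1 x - f2 x) R \<xi> = trunc_fourier f1 R \<xi> - trunc_fourier f2 R \<xi>" for R \<xi>
    unfolding trunc_fourier_def
    using set_integral_diff(2)[OF set_integrable_cis_mult[OF square_integrable_set_integrable[OF sq(1)]]
        set_integrable_cis_mult[OF square_integrable_set_integrable[OF sq(2)]], of "-R" R "-\<xi>" "-\<xi>"]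
    by (simp add: right_diff_distrib)
  let ?I = "\<lambda>f g R. \<integral>\<^sup>+ \<xi>. ennreal ((cmod (g \<xi> - trunc_fourier f R \<xi>))\<^sup>2) \<partial>lborel"
  have "((\<lambda>R. 2 * (?I f1 g1 R + ?I f2 g2 R)) \<longlongrightarrow> 2 * (0 + 0)) at_top"
    using assms by (intro ennreal_tendsto_cmult tendsto_add) (auto simp: has_fourier_trunc)
  then have lim: "((\<lambda>R. 2 * (?I f1 g1 R + ?I f2 g2 R)) \<longlongrightarrow> 0) at_top" by simp
  have le: "?I (\<lambda>x. f1 x - f2 x) (\<lambda>\<xi>. g1 \<xi> - g2 \<xi>) R \<le> 2 * (?I f1 g1 R + ?I f2 g2 R)" for R
    using nn_integral_cmod_diff_square[of "\<lambda>\<xi>. g1 \<xi> - trunc_fourier f1 R \<xi>" "\<lambda>\<xi>. g2 \<xi> - trunc_fourier f2 R \<xi>"]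
    by (simp add: trunc algebra_simps)
  show ?thesis
    unfolding has_fourier_trunc
    by (intro conjI square_integrable_diff sq tendsto_sandwich[OF _ _ tendsto_const lim])
       (use le in \<open>simp_all add: always_eventually\<close>)
qed

text \<open>Uniqueness of limits in the mean: the squared distance of \<open>g\<close> and
  \<open>g'\<close> does not depend on \<open>R\<close>, yet is bounded by errors that tend to
  0.\<close>

lemma has_fourier_unique:
  assumes "has_fourier f g" "has_fourier f g'"
  shows "AE \<xi> in lborel. g \<xi> = g' \<xi>"
proof -
  have sq: "square_integrable f" "square_integrable g" "square_integrable g'"
    using assms by (auto simp: has_fourier_def)
  note [measurable] = sq[THEN square_integrable_measurable]
  let ?I = "\<lambda>f g R. \<integral>\<^sup>+ \<xi>. ennreal ((cmod (g \<xi> - trunc_fourier f R \<xi>))\<^sup>2) \<partial>lborel"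
  have "((\<lambda>R. 2 * (?I f g R + ?I f g' R)) \<longlongrightarrow> 2 * (0 + 0)) at_top"
    using assms by (intro ennreal_tendsto_cmult tendsto_add) (auto simp: has_fourier_trunc)
  then have lim: "((\<lambda>R. 2 * (?I f g R + ?I f g' R)) \<longlongrightarrow> 0) at_top" by simp
  have "(\<integral>\<^sup>+ \<xi>. ennreal ((cmod (g \<xi> - g' \<xi>))\<^sup>2) \<partial>lborel) \<le> 2 * (?I f g R + ?I f g' R)" for R
    using nn_integral_cmod_diff_square[of "\<lambda>\<xi>. g \<xi> - trunc_fourier f R \<xi>" "\<lambda>\<xi>. g' \<xi> - trunc_fourier f R \<xi>"]
    by simp
  then have "(\<integral>\<^sup>+ \<xi>. ennreal ((cmod (g \<xi> - g' \<xi>))\<^sup>2) \<partial>lborel) \<le> 0"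
    by (intro tendsto_lowerbound[OF lim]) auto
  then have "AE \<xi> in lborel. ennreal ((cmod (g \<xi> - g' \<xi>))\<^sup>2) = 0"
    by (subst nn_integral_0_iff_AE[symmetric]) auto
  then show ?thesis by (auto simp: ennreal_eq_0_iff)
qed

section \<open>Pairing the Fourier transform with Gaussians\<close>

text \<open>A rescaled form of the characteristic function of the standard normal distribution,
  evaluated at \<open>y / \<sigma>\<close>.\<close>

lemma integral_cis_gaussian:
  assumes "\<sigma> > 0"
  shows "(LINT \<xi>|lborel. cis (\<xi> * y) * complex_of_real (exp (- (\<sigma> * \<xi>)\<^sup>2 / 2))) =
    complex_of_real (2 * pi * normal_density 0 \<sigma> y)"
proof -
  have "complex_of_real (exp (- ((y / \<sigma>)\<^sup>2) / 2)) = char std_normal_distribution (y / \<sigma>)"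
    by (simp add: char_std_normal_distribution)
  also have "\<dots> = (LINT x|lborel. std_normal_density x *\<^sub>R cis (y / \<sigma> * x))"
    unfolding char_def by (subst integral_density) (auto simp: cis_conv_exp)
  also have "\<dots> = \<bar>\<sigma>\<bar> *\<^sub>R (LINT \<xi>|lborel. std_normal_density (0 + \<sigma> * \<xi>) *\<^sub>R cis (y / \<sigma> * (0 + \<sigma> * \<xi>)))"
    using assms by (intro lborel_integral_real_affine) auto
  also have "\<dots> = (LINT \<xi>|lborel. complex_of_real (\<sigma> / sqrt (2 * pi)) * (cis (\<xi> * y) * complex_of_real (exp (- (\<sigma> * \<xi>)\<^sup>2 / 2))))"
    using assms by (simp add: std_normal_density_def scaleR_conv_of_real mult_ac flip: integral_mult_right_zero)
  also have "\<dots> = complex_of_real (\<sigma> / sqrt (2 * pi)) * (LINT \<xi>|lborel. cis (\<xi> * y) * complex_of_real (exp (- (\<sigma> * \<xi>)\<^sup>2 / 2)))"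
    by (rule integral_mult_right_zero)
  finally have *: "complex_of_real (exp (- ((y / \<sigma>)\<^sup>2) / 2)) = \<dots>" .
  have "(LINT \<xi>|lborel. cis (\<xi> * y) * complex_of_real (exp (- (\<sigma> * \<xi>)\<^sup>2 / 2))) =
      complex_of_real (sqrt (2 * pi) / \<sigma>) * complex_of_real (exp (- ((y / \<sigma>)\<^sup>2) / 2))"
    unfolding * using assms by simp
  also have "\<dots> = complex_of_real (sqrt (2 * pi) / \<sigma> * exp (- ((y / \<sigma>)\<^sup>2) / 2))"
    by simp
  also have "sqrt (2 * pi) / \<sigma> * exp (- ((y / \<sigma>)\<^sup>2) / 2) = 2 * pi * normal_density 0 \<sigma> y"
    using assms by (simp add: normal_density_def real_sqrt_mult power_divide field_simps)
  finally show ?thesis .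
qed

lemma integrable_gaussian:
  fixes \<sigma> :: real
  assumes "\<sigma> > 0"
  shows "integrable lborel (\<lambda>\<xi>. exp (- (\<sigma> * \<xi>)\<^sup>2 / 2))"
proof -
  have "exp (- (\<sigma> * \<xi>)\<^sup>2 / 2) = sqrt (2 * pi) / \<sigma> * normal_density 0 (1 / \<sigma>) \<xi>" for \<xi>
    using assms by (simp add: normal_density_def real_sqrt_divide power_mult_distrib real_sqrt_mult power_divide field_simps)
  then show ?thesis
    using integrable_mult_right[OF integrable_normal_density, of "1 / \<sigma>"] assms by simp
qed

text \<open>Fubini moves the transform from \<open>f\<close> to the Gaussian: for fixed
  \<open>x\<close> the integral over \<xi> is \<open>integral_cis_gaussian\<close> at
  \<open>x0 - x\<close>.\<close>

lemma trunc_fourier_gaussian: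
  assumes "\<sigma> > 0" and f: "square_integrable f"
  shows "(LINT \<xi>|lborel. trunc_fourier f R \<xi> * (cis (\<xi> * x0) * complex_of_real (exp (- (\<sigma> * \<xi>)\<^sup>2 / 2)))) =
    complex_of_real (2 * pi * (LINT x:{-R..R}|lborel. normal_density x0 \<sigma> x * f x))"
proof -
  define e where "e \<xi> = exp (- (\<sigma> * \<xi>)\<^sup>2 / 2)" for \<xi>
  have e_int: "integrable lborel e" unfolding e_def by (rule integrable_gaussian[OF assms(1)])
  have e_pos: "e \<xi> \<ge> 0" for \<xi> by (simp add: e_def)
  have [measurable]: "e \<in> borel_measurable borel" "f \<in> borel_measurable borel"
    using e_int f by (auto simp: square_integrable_def)
  \<comment> \<open>Cutting \<open>f\<close> off to a bounded interval makes it integrable, so the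
    double integral against the integrable \<open>e\<close> converges absolutely.\<close>
  define F where "F x = indicat_real {-R..R} x * f x" for x
  have [measurable]: "F \<in> borel_measurable borel" unfolding F_def by measurable
  have F_int: "integrable lborel F"
    using square_integrable_set_integrable[OF f, of "-R" R] by (simp add: F_def[abs_def] set_integrable_def)
  define h where "h x \<xi> = complex_of_real (F x) * (cis (\<xi> * (x0 - x)) * complex_of_real (e \<xi>))" for x \<xi>
  have "integrable lborel (\<lambda>\<xi>. cis (\<xi> * y) * complex_of_real (e \<xi>))" for y
    by (rule Bochner_Integration.integrable_bound[OF e_int]) (auto simp: norm_mult e_pos)
  then have inner_int: "integrable lborel (\<lambda>\<xi>. h x \<xi>)" for x
    unfolding h_def by simp
  have joint: "integrable (lborel \<Otimes>\<^sub>M lborel) (\<lambda>(x, \<xi>). h x \<xi>)"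
  proof (rule lborel_pair.Fubini_integrable)
    show "(\<lambda>(x, \<xi>). h x \<xi>) \<in> borel_measurable (lborel \<Otimes>\<^sub>M lborel)"
      unfolding h_def by measurable
    have "(LINT \<xi>|lborel. norm (h x \<xi>)) = \<bar>F x\<bar> * (LINT \<xi>|lborel. e \<xi>)" for x
      by (simp add: h_def norm_mult e_pos)
    then show "integrable lborel (\<lambda>x. LINT \<xi>|lborel. norm (case (x, \<xi>) of (x, \<xi>) \<Rightarrow> h x \<xi>))"
      using F_int by simp
  qed (use inner_int in simp)
  have "(LINT \<xi>|lborel. trunc_fourier f R \<xi> * (cis (\<xi> * x0) * complex_of_real (e \<xi>))) =
      (LINT \<xi>|lborel. LINT x|lborel. h x \<xi>)"
  proof (rule Bochner_Integration.integral_cong[OF refl])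
    fix \<xi>
    have "cis (\<xi> * (x0 - x)) = cis (- (\<xi> * x)) * cis (\<xi> * x0)" for x
      by (simp add: cis_mult algebra_simps)
    then have "h x \<xi> = indicat_real {-R..R} x *\<^sub>R (cis (- (\<xi> * x)) * complex_of_real (f x)) *
        (cis (\<xi> * x0) * complex_of_real (e \<xi>))" for x
      by (simp add: h_def F_def scaleR_conv_of_real mult_ac)
    then show "trunc_fourier f R \<xi> * (cis (\<xi> * x0) * complex_of_real (e \<xi>)) = (LINT x|lborel. h x \<xi>)"
      by (simp only: integral_mult_left_zero trunc_fourier_def set_lebesgue_integral_def)
  qed
  also have "\<dots> = (LINT x|lborel. LINT \<xi>|lborel. h x \<xi>)"
    by (rule lborel_pair.Fubini_integral[OF joint])
  also have "\<dots> = (LINT x|lborel. complex_of_real (2 * pi * (F x * normal_density x0 \<sigma> x)))"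
  proof (rule Bochner_Integration.integral_cong[OF refl])
    fix x
    have "(LINT \<xi>|lborel. h x \<xi>) = complex_of_real (F x) * complex_of_real (2 * pi * normal_density 0 \<sigma> (x0 - x))"
      unfolding h_def e_def using integral_cis_gaussian[OF assms(1), of "x0 - x"]
      by (simp only: integral_mult_right_zero)
    also have "normal_density 0 \<sigma> (x0 - x) = normal_density x0 \<sigma> x"
      by (simp add: normal_density_def power2_commute)
    finally show "(LINT \<xi>|lborel. h x \<xi>) = complex_of_real (2 * pi * (F x * normal_density x0 \<sigma> x))"
      by simp
  qed
  also have "\<dots> = complex_of_real (LINT x|lborel. 2 * pi * (F x * normal_density x0 \<sigma> x))"
    by (rule integral_complex_of_real)
  also have "(LINT x|lborel. 2 * pi * (F x * normal_density x0 \<sigma> x)) =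
      2 * pi * (LINT x:{-R..R}|lborel. normal_density x0 \<sigma> x * f x)"
    unfolding integral_mult_right_zero by (simp add: F_def set_lebesgue_integral_def mult_ac)
  finally show ?thesis by (simp only: e_def)
qed

lemma normal_density_bounded:
  assumes "\<sigma> > 0"
  shows "normal_density \<mu> \<sigma> x \<le> 1 / \<sigma>"
proof -
  have "1 * \<sigma> \<le> sqrt (2 * pi) * \<sigma>"
    using assms pi_gt3 by (intro mult_right_mono) auto
  then have "1 / sqrt (2 * pi * \<sigma>\<^sup>2) \<le> 1 / \<sigma>"
    using assms by (simp add: real_sqrt_mult frac_le)
  moreover have "exp (- (x - \<mu>)\<^sup>2 / (2 * \<sigma>\<^sup>2)) \<le> 1" by simp
  ultimately show ?thesis
    unfolding normal_density_def using assms by (meson mult_left_le order_trans real_sqrt_ge_zero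
        divide_nonneg_nonneg exp_ge_zero zero_le_one mult_nonneg_nonneg zero_le_power2 pi_ge_zero zero_le_numeral)
qed

text \<open>The bound \<open>\<bar>y\<bar> \<le> 1 + y\<^sup>2\<close> splits the product into the
  density and the density times \<open>f\<^sup>2\<close>; the latter is integrable because the
  density is bounded.\<close>

lemma integrable_normal_density_mult:
  assumes "\<sigma> > 0" and f: "square_integrable f"
  shows "integrable lborel (\<lambda>x. normal_density \<mu> \<sigma> x * f x)"
proof (rule Bochner_Integration.integrable_bound)
  show "integrable lborel (\<lambda>x. normal_density \<mu> \<sigma> x + 1 / \<sigma> * (norm (f x))\<^sup>2)"
    using f integrable_normal_density[OF assms(1)] unfolding square_integrable_def
    by (intro Bochner_Integration.integrable_add integrable_mult_right) auto
  have [measurable]: "f \<in> borel_measurable borel"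
    using f by (rule square_integrable_measurable)
  show "(\<lambda>x. normal_density \<mu> \<sigma> x * f x) \<in> borel_measurable lborel"
    by measurable
  have y: "\<bar>y\<bar> \<le> 1 + y\<^sup>2" for y :: real
    using abs_le_weighted_square[of 1 y] by simp
  have "\<bar>normal_density \<mu> \<sigma> x * f x\<bar> \<le> normal_density \<mu> \<sigma> x + 1 / \<sigma> * (f x)\<^sup>2" for x
  proof -
    have "\<bar>normal_density \<mu> \<sigma> x * f x\<bar> \<le> normal_density \<mu> \<sigma> x * (1 + (f x)\<^sup>2)"
      unfolding abs_mult using y by (simp add: mult_left_mono)
    also have "\<dots> \<le> normal_density \<mu> \<sigma> x + 1 / \<sigma> * (f x)\<^sup>2"
      using mult_right_mono[OF normal_density_bounded[OF assms(1)], of "(f x)\<^sup>2" \<mu> x]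
      by (simp add: distrib_left)
    finally show ?thesis .
  qed
  then show "AE x in lborel. norm (normal_density \<mu> \<sigma> x * f x) \<le> norm (normal_density \<mu> \<sigma> x + 1 / \<sigma> * (norm (f x))\<^sup>2)"
    by (intro AE_I2) (simp add: abs_of_nonneg[OF add_nonneg_nonneg] assms(1) less_imp_le)
qed

text \<open>The Gaussian \<open>e\<close> below is bounded and integrable, so after Fubini the truncated transforms can be
  replaced by \<open>g\<close> at a cost of \<open>?E / q + q * I R\<close>, where \<open>I R\<close> tends to 0; then \<open>q\<close> tends to \<open>\<infinity>\<close>.\<close>

lemma gaussian_mean_le_fourier:
  assumes "\<sigma> > 0" and fg: "has_fourier f g" and g: "integrable lborel g"
  shows "\<bar>LINT x|lborel. normal_density x0 \<sigma> x * f x\<bar> \<le> (LINT \<xi>|lborel. cmod (g \<xi>)) / (2 * pi)"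
proof -
  have f: "square_integrable f" and [measurable]: "f \<in> borel_measurable borel" "g \<in> borel_measurable borel"
    using fg by (auto simp: has_fourier_def square_integrable_def)
  let ?J = "LINT x|lborel. normal_density x0 \<sigma> x * f x"
  let ?G = "LINT \<xi>|lborel. cmod (g \<xi>)"
  define J where "J R = (LINT x:{-R..R}|lborel. normal_density x0 \<sigma> x * f x)" for R
  define e where "e \<xi> = exp (- (\<sigma> * \<xi>)\<^sup>2 / 2)" for \<xi>
  have e_int: "integrable lborel e" unfolding e_def by (rule integrable_gaussian[OF assms(1)])
  have e: "e \<xi> \<ge> 0" "e \<xi> \<le> 1" for \<xi> by (auto simp: e_def)
  have [measurable]: "e \<in> borel_measurable borel" using e_int by auto
  let ?E = "LINT \<xi>|lborel. e \<xi>"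
  define I where "I R = (\<integral>\<^sup>+ \<xi>. ennreal ((cmod (g \<xi> - trunc_fourier f R \<xi>))\<^sup>2) \<partial>lborel)" for R
  have J_lim: "(J \<longlongrightarrow> ?J) at_top"
    unfolding J_def set_lebesgue_integral_def
  proof (rule integral_dominated_convergence_at_top)
    show "integrable lborel (\<lambda>x. \<bar>normal_density x0 \<sigma> x * f x\<bar>)"
      using integrable_normal_density_mult[OF assms(1) f] by (rule integrable_abs)
    have "\<forall>\<^sub>F R in at_top. indicat_real {-R..R} x *\<^sub>R (normal_density x0 \<sigma> x * f x) = normal_density x0 \<sigma> x * f x" for x
      using eventually_ge_at_top[of "\<bar>x\<bar>"] by eventually_elim (auto simp: indicator_def abs_le_iff)
    then show "AE x in lborel. ((\<lambda>R. indicat_real {-R..R} x *\<^sub>R (normal_density x0 \<sigma> x * f x)) \<longlongrightarrow>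
        normal_density x0 \<sigma> x * f x) at_top"
      by (simp add: tendsto_eventually)
  qed (auto simp: indicator_def)
  \<comment> \<open>Stated in \<open>ennreal\<close> because only the limit of \<open>I R\<close> is
    known, not its finiteness for each \<open>R\<close>.\<close>
  have J_le: "ennreal (2 * pi * \<bar>J R\<bar>) \<le> ennreal (?G + ?E / q) + ennreal q * I R" if "q > 0" for q R
  proof -
    have "ennreal (2 * pi * \<bar>J R\<bar>) = ennreal (norm (LINT \<xi>|lborel. trunc_fourier f R \<xi> * (cis (\<xi> * x0) * complex_of_real (e \<xi>))))"
      unfolding e_def trunc_fourier_gaussian[OF assms(1) f] J_def by (simp add: norm_mult)
    also have "\<dots> \<le> (\<integral>\<^sup>+ \<xi>. norm (trunc_fourier f R \<xi> * (cis (\<xi> * x0) * complex_of_real (e \<xi>))) \<partial>lborel)"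
      \<comment> \<open>Without integrability the Bochner integral is 0 by convention, and the bound
        is trivial.\<close>
      by (cases "integrable lborel (\<lambda>\<xi>. trunc_fourier f R \<xi> * (cis (\<xi> * x0) * complex_of_real (e \<xi>)))")
         (auto simp: not_integrable_integral_eq intro: integral_norm_bound_ennreal)
    also have "\<dots> \<le> (\<integral>\<^sup>+ \<xi>. ennreal (cmod (g \<xi>) + e \<xi> / q) + ennreal q * ennreal ((cmod (g \<xi> - trunc_fourier f R \<xi>))\<^sup>2) \<partial>lborel)"
    proof (rule nn_integral_mono)
      fix \<xi>
      define d where "d = cmod (g \<xi> - trunc_fourier f R \<xi>)"
      have "d \<ge> 0" by (simp add: d_def)
      have "cmod (trunc_fourier f R \<xi>) \<le> cmod (g \<xi>) + d"
        unfolding d_def by (metis norm_minus_commute norm_triangle_sub)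
      moreover have "d \<le> 1 / q + q * d\<^sup>2"
        using abs_le_weighted_square[OF that, of d] \<open>d \<ge> 0\<close> by simp
      ultimately have "cmod (trunc_fourier f R \<xi>) * e \<xi> \<le> (cmod (g \<xi>) + (1 / q + q * d\<^sup>2)) * e \<xi>"
        by (intro mult_right_mono e) linarith
      also have "\<dots> = cmod (g \<xi>) * e \<xi> + e \<xi> / q + q * d\<^sup>2 * e \<xi>" by (simp add: algebra_simps)
      \<comment> \<open>The factor \<open>e \<xi> \<le> 1\<close> is dropped except beside
        \<open>1 / q\<close>, where it keeps the constant integrable.\<close>
      also have "\<dots> \<le> cmod (g \<xi>) + e \<xi> / q + q * d\<^sup>2"
        using e[of \<xi>] that by (intro add_mono mult_left_le order_refl) auto
      finally have "norm (trunc_fourier f R \<xi> * (cis (\<xi> * x0) * complex_of_real (e \<xi>))) \<le> cmod (g \<xi>) + e \<xi> / q + q * d\<^sup>2"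
        by (simp add: norm_mult e)
      then show "ennreal (norm (trunc_fourier f R \<xi> * (cis (\<xi> * x0) * complex_of_real (e \<xi>))))
          \<le> ennreal (cmod (g \<xi>) + e \<xi> / q) + ennreal q * ennreal ((cmod (g \<xi> - trunc_fourier f R \<xi>))\<^sup>2)"
        using that e[of \<xi>] unfolding d_def by (simp add: ennreal_mult'[symmetric] ennreal_plus[symmetric] ennreal_leI del: ennreal_plus)
    qed
    also have "\<dots> = (\<integral>\<^sup>+ \<xi>. ennreal (cmod (g \<xi>) + e \<xi> / q) \<partial>lborel) + ennreal q * I R"
      unfolding I_def by (subst nn_integral_add) (auto simp: nn_integral_cmult)
    also have "(\<integral>\<^sup>+ \<xi>. ennreal (cmod (g \<xi>) + e \<xi> / q) \<partial>lborel) = ennreal (LINT \<xi>|lborel. cmod (g \<xi>) + e \<xi> / q)"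
      using g e_int e that by (intro nn_integral_eq_integral) auto
    also have "(LINT \<xi>|lborel. cmod (g \<xi>) + e \<xi> / q) = ?G + ?E / q"
      using g e_int by simp
    finally show ?thesis .
  qed
  have le: "2 * pi * \<bar>?J\<bar> \<le> ?G + ?E / q" if "q > 0" for q
  proof -
    have "((\<lambda>R. ennreal (?G + ?E / q) + ennreal q * I R) \<longlongrightarrow> ennreal (?G + ?E / q) + ennreal q * 0) at_top"
      using fg unfolding has_fourier_trunc I_def
      by (intro tendsto_add tendsto_const ennreal_tendsto_cmult) auto
    moreover have "((\<lambda>R. ennreal (2 * pi * \<bar>J R\<bar>)) \<longlongrightarrow> ennreal (2 * pi * \<bar>?J\<bar>)) at_top"
      by (intro tendsto_intros J_lim)
    ultimately have "ennreal (2 * pi * \<bar>?J\<bar>) \<le> ennreal (?G + ?E / q) + ennreal q * 0"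
      by (rule tendsto_le[OF trivial_limit_at_top_linorder]) (use J_le[OF that] in simp)
    moreover have "?G + ?E / q \<ge> 0"
      using e that by (intro add_nonneg_nonneg divide_nonneg_nonneg integral_nonneg) auto
    ultimately show ?thesis by simp
  qed
  have "((\<lambda>q. ?G + ?E / q) \<longlongrightarrow> ?G + 0) at_top"
    by (intro tendsto_intros tendsto_divide_0[OF tendsto_const] filterlim_at_top_imp_at_infinity filterlim_ident)
  then have "2 * pi * \<bar>?J\<bar> \<le> ?G + 0"
    by (rule tendsto_lowerbound) (auto intro: eventually_mono[OF eventually_gt_at_top[of 0]] le)
  then show ?thesis by (simp add: field_simps)
qed

subsection \<open>Pointwise bounds\<close>

text \<open>In the variable \<open>z\<close> the left side is \<sigma> times
  \<open>2 / sqrt (2 * pi)\<close> times \<open>z * exp (- z)\<close>, and the last two factors are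
  at most 1.\<close>

lemma normal_density_times_square_le:
  assumes "\<sigma> > 0"
  shows "normal_density \<mu> \<sigma> x * (x - \<mu>)\<^sup>2 \<le> \<sigma>"
proof -
  define z where "z = (x - \<mu>)\<^sup>2 / (2 * \<sigma>\<^sup>2)"
  have "z \<ge> 0" by (simp add: z_def)
  have "z * exp (- z) \<le> 1"
  proof -
    have "z \<le> exp z" using exp_ge_add_one_self[of z] by linarith
    then show ?thesis by (simp add: exp_minus field_simps)
  qed
  have "2 \<le> sqrt (2 * pi)"
    using pi_gt3 by (intro real_le_rsqrt) simp
  then have "2 / sqrt (2 * pi) \<le> 1" by simp
  have "normal_density \<mu> \<sigma> x * (x - \<mu>)\<^sup>2 = \<sigma> * (2 / sqrt (2 * pi) * (z * exp (- z)))"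
  proof -
    have "normal_density \<mu> \<sigma> x = exp (- z) / (sqrt (2 * pi) * \<sigma>)"
      using assms by (simp add: normal_density_def z_def real_sqrt_mult)
    moreover have "(x - \<mu>)\<^sup>2 = 2 * \<sigma>\<^sup>2 * z" using assms by (simp add: z_def)
    ultimately show ?thesis using assms by (simp add: power2_eq_square)
  qed
  also have "\<dots> \<le> \<sigma> * (1 * 1)"
    using assms \<open>z \<ge> 0\<close> \<open>z * exp (- z) \<le> 1\<close> \<open>2 / sqrt (2 * pi) \<le> 1\<close>
    by (intro mult_left_mono mult_mono) auto
  finally show ?thesis by simp
qed

text \<open>Away from \<open>x0\<close> the Gaussian is controlled through its second moment, which is small both in mean
  and, by the preceding lemma, uniformly; the latter absorbs the unbounded \<open>f\<^sup>2\<close>.\<close>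

lemma value_le_gaussian_means:
  assumes f: "square_integrable f" and cont: "isCont f x0"
    and bound: "\<And>\<sigma>. \<sigma> > 0 \<Longrightarrow> \<bar>LINT x|lborel. normal_density x0 \<sigma> x * f x\<bar> \<le> C"
  shows "\<bar>f x0\<bar> \<le> (C :: real)"
proof (rule field_le_epsilon)
  fix \<eta> :: real assume "\<eta> > 0"
  have [measurable]: "f \<in> borel_measurable borel" using f by (rule square_integrable_measurable)
  have f2: "integrable lborel (\<lambda>x. (f x)\<^sup>2)" using f by (simp add: square_integrable_def)
  obtain \<delta> where "\<delta> > 0" and \<delta>: "\<And>x. \<bar>x - x0\<bar> < \<delta> \<Longrightarrow> \<bar>f x - f x0\<bar> < \<eta>"
    using cont \<open>\<eta> > 0\<close> unfolding continuous_at_eps_delta dist_real_def by metis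
  let ?I = "LINT x|lborel. (f x)\<^sup>2"
  have le: "\<bar>f x0\<bar> \<le> C + (\<eta> + (1 + \<bar>f x0\<bar>) / \<delta>\<^sup>2 * \<sigma>\<^sup>2 + \<sigma> / \<delta>\<^sup>2 * ?I)" if "\<sigma> > 0" for \<sigma>
  proof -
    let ?N = "normal_density x0 \<sigma>"
    \<comment> \<open>A majorant with one term for each error: continuity near \<open>x0\<close>,
      the second moment for the constants away from \<open>x0\<close>, and the integral of
      \<open>f\<^sup>2\<close>. The exponent \<open>2 * 1\<close> fits the formula for even
      moments.\<close>
    let ?w = "\<lambda>x. \<eta> * ?N x + (1 + \<bar>f x0\<bar>) / \<delta>\<^sup>2 * (?N x * (x - x0)^(2 * 1)) + \<sigma> / \<delta>\<^sup>2 * (f x)\<^sup>2"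
    have N_int: "integrable lborel ?N" by (rule integrable_normal_density[OF that])
    have Nf_int: "integrable lborel (\<lambda>x. ?N x * f x)" by (rule integrable_normal_density_mult[OF that f])
    have w_int: "integrable lborel ?w"
      using N_int integrable_normal_moment[OF that, of x0 "2 * 1"] f2
      by (intro Bochner_Integration.integrable_add integrable_mult_right) auto
    have w: "\<bar>?N x * f x - ?N x * f x0\<bar> \<le> ?w x" for x
    proof (cases "\<bar>x - x0\<bar> < \<delta>")
      case True
      have "\<bar>?N x * f x - ?N x * f x0\<bar> = \<bar>f x - f x0\<bar> * ?N x"
        by (simp add: abs_mult flip: right_diff_distrib)
      also have "\<dots> \<le> \<eta> * ?N x"
        using \<delta>[OF True] by (intro mult_right_mono) auto
      also have "\<dots> \<le> ?w x"
        using that by (simp add: add_nonneg_nonneg add.assoc)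
      finally show ?thesis .
    next
      case False
      then have "\<delta>\<^sup>2 \<le> (x - x0)\<^sup>2"
        using \<open>\<delta> > 0\<close> abs_le_square_iff[of \<delta> "x - x0"] by simp
      then have q: "1 \<le> (x - x0)\<^sup>2 / \<delta>\<^sup>2" using \<open>\<delta> > 0\<close> by simp
      have "\<bar>y\<bar> \<le> 1 + y\<^sup>2" for y :: real
        using abs_le_weighted_square[of 1 y] by simp
      then have "\<bar>f x - f x0\<bar> \<le> 1 + \<bar>f x0\<bar> + (f x)\<^sup>2"
        by (smt (verit))
      then have "\<bar>?N x * f x - ?N x * f x0\<bar> \<le> ?N x * (1 + \<bar>f x0\<bar> + (f x)\<^sup>2)"
        by (simp add: abs_mult mult_left_mono flip: right_diff_distrib)
      also have "\<dots> \<le> ?N x * (1 + \<bar>f x0\<bar> + (f x)\<^sup>2) * ((x - x0)\<^sup>2 / \<delta>\<^sup>2)"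
        using mult_left_mono[OF q, of "?N x * (1 + \<bar>f x0\<bar> + (f x)\<^sup>2)"] by simp
      also have "\<dots> = (1 + \<bar>f x0\<bar>) / \<delta>\<^sup>2 * (?N x * (x - x0)^(2 * 1)) + (?N x * (x - x0)\<^sup>2) * ((f x)\<^sup>2 / \<delta>\<^sup>2)"
        by (simp add: distrib_left distrib_right add_divide_distrib mult_ac)
      also have "(?N x * (x - x0)\<^sup>2) * ((f x)\<^sup>2 / \<delta>\<^sup>2) \<le> \<sigma> * ((f x)\<^sup>2 / \<delta>\<^sup>2)"
        by (intro mult_right_mono normal_density_times_square_le that) simp
      finally show ?thesis using \<open>\<eta> > 0\<close> by (simp add: add.assoc add_increasing)
    qed
    have "(LINT x|lborel. ?N x * f x - ?N x * f x0) = (LINT x|lborel. ?N x * f x) - f x0"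
      using N_int Nf_int that by simp
    then have "\<bar>(LINT x|lborel. ?N x * f x) - f x0\<bar> \<le> (LINT x|lborel. \<bar>?N x * f x - ?N x * f x0\<bar>)"
      using integral_abs_bound[of lborel "\<lambda>x. ?N x * f x - ?N x * f x0"] by simp
    also have "\<dots> \<le> (LINT x|lborel. ?w x)"
      using N_int Nf_int w by (intro integral_mono integrable_abs Bochner_Integration.integrable_diff w_int) auto
    also have "\<dots> = \<eta> * 1 + (1 + \<bar>f x0\<bar>) / \<delta>\<^sup>2 * \<sigma>\<^sup>2 + \<sigma> / \<delta>\<^sup>2 * ?I"
    proof -
      have "integrable lborel (\<lambda>x. ?N x * (x - x0)^(2 * 1))"
        by (rule integrable_normal_moment[OF that])
      moreover have "(LINT x|lborel. ?N x * (x - x0)^(2 * 1)) = \<sigma>\<^sup>2"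
        using integral_normal_moment_even[OF that, of x0 1] by simp
      ultimately show ?thesis
        using N_int f2 integral_normal_density[OF that, of x0] by simp
    qed
    finally show ?thesis using bound[OF that] by linarith
  qed
  \<comment> \<open>As the Gaussians concentrate, both terms containing \<sigma> disappear; \<delta>
    was chosen before \<sigma> and stays fixed.\<close>
  have "((\<lambda>\<sigma>. C + (\<eta> + (1 + \<bar>f x0\<bar>) / \<delta>\<^sup>2 * \<sigma>\<^sup>2 + \<sigma> / \<delta>\<^sup>2 * ?I)) \<longlongrightarrow>
      C + (\<eta> + (1 + \<bar>f x0\<bar>) / \<delta>\<^sup>2 * 0\<^sup>2 + 0 / \<delta>\<^sup>2 * ?I)) (at_right 0)"
    using \<open>\<delta> > 0\<close> by (intro tendsto_intros) auto
  then have "\<bar>f x0\<bar> \<le> C + (\<eta> + (1 + \<bar>f x0\<bar>) / \<delta>\<^sup>2 * 0\<^sup>2 + 0 / \<delta>\<^sup>2 * ?I)"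
  proof (rule tendsto_lowerbound)
    show "\<forall>\<^sub>F \<sigma> in at_right 0. \<bar>f x0\<bar> \<le> C + (\<eta> + (1 + \<bar>f x0\<bar>) / \<delta>\<^sup>2 * \<sigma>\<^sup>2 + \<sigma> / \<delta>\<^sup>2 * ?I)"
      by (rule eventually_mono[OF eventually_at_right_less]) (rule le)
  qed simp
  then show "\<bar>f x0\<bar> \<le> C + \<eta>" by simp
qed

text \<open>Takes the place of pointwise Fourier inversion; continuity at the single point
  \<open>x\<close> ties the value there to the Gaussian means.\<close>

lemma value_le_fourier_integral:
  assumes "has_fourier f g" "integrable lborel g" "isCont f x"
  shows "\<bar>f x\<bar> \<le> (LINT \<xi>|lborel. cmod (g \<xi>)) / (2 * pi)"
proof (rule value_le_gaussian_means[where f = f and ?x0.0 = x])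
  show "square_integrable f" using assms(1) by (simp add: has_fourier_def)
  show "\<bar>LINT y|lborel. normal_density x \<sigma> y * f y\<bar> \<le> (LINT \<xi>|lborel. cmod (g \<xi>)) / (2 * pi)" if "\<sigma> > 0" for \<sigma>
    by (rule gaussian_mean_le_fourier[OF that assms(1,2)])
qed (rule assms(3))

text \<open>The difference has a transform that vanishes almost everywhere, so
  \<open>value_le_fourier_integral\<close> bounds it by 0.\<close>

lemma fourier_injective:
  assumes "has_fourier f k" "has_fourier h k'" "AE \<xi> in lborel. k \<xi> = k' \<xi>"
    and "isCont f x" "isCont h x"
  shows "f x = h x"
proof -
  have [measurable]: "k \<in> borel_measurable borel" "k' \<in> borel_measurable borel"
    using assms by (auto simp: has_fourier_def square_integrable_def)
  have zero: "AE \<xi> in lborel. k \<xi> - k' \<xi> = 0" using assms(3) by auto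
  have "integrable lborel (\<lambda>\<xi>. k \<xi> - k' \<xi>)"
  proof (rule integrable_cong_AE_imp)
    show "integrable lborel (\<lambda>_ :: real. 0 :: complex)" by simp
    show "AE \<xi> in lborel. 0 = k \<xi> - k' \<xi>" using zero by eventually_elim simp
  qed measurable
  moreover have "(LINT \<xi>|lborel. cmod (k \<xi> - k' \<xi>)) = 0"
    using zero by (intro integral_eq_zero_AE) auto
  ultimately have "\<bar>f x - h x\<bar> \<le> 0"
    using value_le_fourier_integral[OF has_fourier_diff[OF assms(1,2)], of x] assms(4,5) by simp
  then show ?thesis by simp
qed

text \<open>The two hypotheses may involve different transforms of \<open>u\<close>; these agree
  almost everywhere, hence so do those of \<open>m\<close> and \<open>m'\<close>.\<close>

lemma is_inertia_unique:
  assumes "is_inertia r u m" "is_inertia r u m'" "isCont m x" "isCont m' x"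
  shows "m x = m' x"
proof -
  obtain g k where gk: "has_fourier u g" "has_fourier m k"
      "AE \<xi> in lborel. k \<xi> = complex_of_real ((1 + \<xi>\<^sup>2) powr r) * g \<xi>"
    using assms(1) by (auto simp: is_inertia_def is_fourier_multiplier_def)
  obtain g' k' where gk': "has_fourier u g'" "has_fourier m' k'"
      "AE \<xi> in lborel. k' \<xi> = complex_of_real ((1 + \<xi>\<^sup>2) powr r) * g' \<xi>"
    using assms(2) by (auto simp: is_inertia_def is_fourier_multiplier_def)
  have "AE \<xi> in lborel. k \<xi> = k' \<xi>"
    using gk(3) gk'(3) has_fourier_unique[OF gk(1) gk'(1)] by eventually_elim simp
  then show ?thesis using fourier_injective gk(2) gk'(2) assms(3,4) by blast
qed

section \<open>Sobolev spaces: sup bounds and boundedness in time\<close>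

text \<open>Continuity in time controls norms of differences, and \<open>sobolev_sup_bound\<close>
  applies only to members of the space.\<close>

lemma sobolev_diff:
  assumes "f \<in> sobolev s" "h \<in> sobolev s"
  shows "(\<lambda>x. f x - h x) \<in> sobolev s"
proof -
  obtain g where g: "has_fourier f g" "integrable lborel (\<lambda>\<xi>. (1 + \<xi>\<^sup>2) powr s * (cmod (g \<xi>))\<^sup>2)"
    using assms(1) by (auto simp: sobolev_def)
  obtain k where k: "has_fourier h k" "integrable lborel (\<lambda>\<xi>. (1 + \<xi>\<^sup>2) powr s * (cmod (k \<xi>))\<^sup>2)"
    using assms(2) by (auto simp: sobolev_def)
  have [measurable]: "g \<in> borel_measurable borel" "k \<in> borel_measurable borel"
    using g(1) k(1) by (auto simp: has_fourier_def square_integrable_def)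
  define W where "W \<xi> = 2 * ((1 + \<xi>\<^sup>2) powr s * (cmod (g \<xi>))\<^sup>2 + (1 + \<xi>\<^sup>2) powr s * (cmod (k \<xi>))\<^sup>2)" for \<xi>
  have "integrable lborel W"
    unfolding W_def using g(2) k(2) by (intro integrable_mult_right Bochner_Integration.integrable_add)
  then have "integrable lborel (\<lambda>\<xi>. (1 + \<xi>\<^sup>2) powr s * (cmod (g \<xi> - k \<xi>))\<^sup>2)"
  proof (rule Bochner_Integration.integrable_bound)
    have "(1 + \<xi>\<^sup>2) powr s * (cmod (g \<xi> - k \<xi>))\<^sup>2 \<le> W \<xi>" for \<xi>
      using mult_left_mono[OF norm_diff_square_le[of "g \<xi>" "k \<xi>"], of "(1 + \<xi>\<^sup>2) powr s"]
      by (simp add: W_def algebra_simps)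
    then show "AE \<xi> in lborel. norm ((1 + \<xi>\<^sup>2) powr s * (cmod (g \<xi> - k \<xi>))\<^sup>2) \<le> norm (W \<xi>)"
      by (intro AE_I2) (simp add: order_trans[OF _ abs_ge_self])
  qed measurable
  then show ?thesis using has_fourier_diff[OF g(1) k(1)] by (auto simp: sobolev_def)
qed

lemma inverse_1_plus_square_lborel:
  shows integrable_inverse_1_plus_square_lborel: "integrable lborel (\<lambda>x::real. inverse (1 + x\<^sup>2))"
    and integral_inverse_1_plus_square_lborel: "(LINT x|lborel. inverse (1 + x\<^sup>2)) = pi"
  using integrable_inverse_1_plus_square LBINT_inverse_1_plus_square
  by (simp_all add: set_integrable_def interval_lebesgue_integral_def set_lebesgue_integral_def)

text \<open>Splitting \<open>cmod (k \<xi>)\<close> with weight \<open>1 + \<xi>\<^sup>2\<close>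
  gives an integrable majorant of the transform. The bound is not homogeneous in the norm, but it
  suffices for boundedness.\<close>

lemma sobolev_sup_bound:
  assumes s: "s \<ge> 1" and f: "f \<in> sobolev s" and cont: "isCont f x"
  shows "\<bar>f x\<bar> \<le> 1 + (sobolev_norm s f)\<^sup>2"
proof -
  obtain g where g: "has_fourier f g" "integrable lborel (\<lambda>\<xi>. (1 + \<xi>\<^sup>2) powr s * (cmod (g \<xi>))\<^sup>2)"
    using f by (auto simp: sobolev_def)
  \<comment> \<open>The norm uses the chosen transform \<open>fourier f\<close>, whereas membership
    provides some \<open>g\<close>; uniqueness transfers integrability from \<open>g\<close> to
    \<open>k\<close>.\<close>
  define k where "k = fourier f"
  have k: "has_fourier f k"
    unfolding k_def fourier_def by (rule someI[where P = "has_fourier f", OF g(1)])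
  have [measurable]: "g \<in> borel_measurable borel" "k \<in> borel_measurable borel"
    using g(1) k by (auto simp: has_fourier_def square_integrable_def)
  define W where "W \<xi> = (1 + \<xi>\<^sup>2) powr s * (cmod (k \<xi>))\<^sup>2" for \<xi>
  have W_nonneg: "W \<xi> \<ge> 0" for \<xi> by (simp add: W_def)
  have W_int: "integrable lborel W"
  proof (rule integrable_cong_AE_imp[OF g(2)])
    show "W \<in> borel_measurable lborel" unfolding W_def by measurable
    show "AE \<xi> in lborel. (1 + \<xi>\<^sup>2) powr s * (cmod (g \<xi>))\<^sup>2 = W \<xi>"
      using has_fourier_unique[OF g(1) k] by eventually_elim (simp add: W_def)
  qed
  have norm_eq: "(sobolev_norm s f)\<^sup>2 = (LINT \<xi>|lborel. W \<xi>)"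
    using W_nonneg by (simp add: sobolev_norm_def W_def k_def)
  have le: "cmod (k \<xi>) \<le> inverse (1 + \<xi>\<^sup>2) + W \<xi>" for \<xi>
  proof -
    define p where "p = 1 + \<xi>\<^sup>2"
    have "p \<ge> 1" by (simp add: p_def)
    define y where "y = cmod (k \<xi>)"
    have "y \<ge> 0" by (simp add: y_def)
    then have "y \<le> inverse p + p * y\<^sup>2"
      using abs_le_weighted_square[of p y] \<open>p \<ge> 1\<close> by (simp add: inverse_eq_divide)
    also have "p * y\<^sup>2 \<le> p powr s * y\<^sup>2"
      using powr_mono[OF s \<open>p \<ge> 1\<close>] \<open>p \<ge> 1\<close> by (intro mult_right_mono) auto
    finally show ?thesis by (simp add: W_def p_def y_def)
  qed
  have dom: "integrable lborel (\<lambda>\<xi>. inverse (1 + \<xi>\<^sup>2) + W \<xi>)"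
    using integrable_inverse_1_plus_square_lborel W_int by simp
  have k_int: "integrable lborel k"
    by (rule Bochner_Integration.integrable_bound[OF dom]) (auto intro: order_trans[OF le abs_ge_self])
  have "(LINT \<xi>|lborel. cmod (k \<xi>)) \<le> (LINT \<xi>|lborel. inverse (1 + \<xi>\<^sup>2) + W \<xi>)"
    using k_int dom le by (intro integral_mono) auto
  also have "\<dots> = pi + (sobolev_norm s f)\<^sup>2"
    using integrable_inverse_1_plus_square_lborel W_int
    by (simp add: norm_eq integral_inverse_1_plus_square_lborel)
  also have "\<dots> \<le> (1 + (sobolev_norm s f)\<^sup>2) * (2 * pi)"
  proof -
    have "1 * (sobolev_norm s f)\<^sup>2 \<le> 2 * pi * (sobolev_norm s f)\<^sup>2"
      using pi_gt3 by (intro mult_right_mono) auto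
    then show ?thesis by (simp add: algebra_simps add_increasing)
  qed
  finally have "(LINT \<xi>|lborel. cmod (k \<xi>)) / (2 * pi) \<le> 1 + (sobolev_norm s f)\<^sup>2"
    by (simp add: pos_divide_le_eq)
  with value_le_fourier_integral[OF k k_int cont] show ?thesis by linarith
qed

text \<open>Continuity in the norm bounds \<open>u\<close> near each time, uniformly in
  \<open>x\<close>; compactness leaves finitely many such bounds.\<close>

lemma sobolev_continuous_on_bounded:
  assumes s: "s \<ge> 1" and u: "sobolev_continuous_on s I u"
    and cont: "\<And>t x. t \<in> I \<Longrightarrow> isCont (u t) x" and K: "compact K" "K \<subseteq> I"
  obtains M where "\<And>t x. t \<in> K \<Longrightarrow> \<bar>u t x\<bar> \<le> M"
proof -
  have "\<exists>d>0. \<exists>B. \<forall>t'\<in>I. dist t' t < d \<longrightarrow> (\<forall>x. \<bar>u t' x\<bar> \<le> B)" if t: "t \<in> I" for t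
  proof -
    have mem: "u t' \<in> sobolev s" if "t' \<in> I" for t'
      using u that by (simp add: sobolev_continuous_on_def)
    have "((\<lambda>t'. sobolev_norm s (\<lambda>x. u t' x - u t x)) \<longlongrightarrow> 0) (at t within I)"
      using u t by (simp add: sobolev_continuous_on_def)
    from tendstoD[OF this, of 1]
    have "\<forall>\<^sub>F t' in at t within I. \<bar>sobolev_norm s (\<lambda>x. u t' x - u t x)\<bar> < 1"
      by (simp add: dist_real_def)
    then obtain d where "d > 0" and d: "\<And>t'. t' \<in> I \<Longrightarrow> t' \<noteq> t \<Longrightarrow> dist t' t < d \<Longrightarrow>
        \<bar>sobolev_norm s (\<lambda>x. u t' x - u t x)\<bar> < 1"
      by (auto simp: eventually_at)
    have "\<bar>u t' x\<bar> \<le> (1 + (sobolev_norm s (u t))\<^sup>2) + 2" if t': "t' \<in> I" "dist t' t < d" for t' x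
    proof -
      \<comment> \<open>The limit says nothing about \<open>t' = t\<close>, where the difference is
        0. Elsewhere a norm below 1 gives the bound \<open>1 + 1\<^sup>2\<close>.\<close>
      have "\<bar>u t' x - u t x\<bar> \<le> 2"
      proof (cases "t' = t")
        case False
        have "\<bar>u t' x - u t x\<bar> \<le> 1 + (sobolev_norm s (\<lambda>x. u t' x - u t x))\<^sup>2"
          using sobolev_sup_bound[OF s sobolev_diff[OF mem mem], of t' t x] t t' cont by simp
        also have "(sobolev_norm s (\<lambda>x. u t' x - u t x))\<^sup>2 \<le> 1"
          using d[OF t'(1) False t'(2)] by (simp add: abs_square_le_1 less_imp_le)
        finally show ?thesis by simp
      qed simp
      moreover have "\<bar>u t x\<bar> \<le> 1 + (sobolev_norm s (u t))\<^sup>2"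
        by (rule sobolev_sup_bound[OF s mem[OF t] cont[OF t]])
      ultimately show ?thesis by linarith
    qed
    then show ?thesis using \<open>d > 0\<close> by blast
  qed
  then obtain d B where d: "\<And>t. t \<in> I \<Longrightarrow> d t > 0"
    and B: "\<And>t t' x. t \<in> I \<Longrightarrow> t' \<in> I \<Longrightarrow> dist t' t < d t \<Longrightarrow> \<bar>u t' x\<bar> \<le> (B t :: real)"
    by metis
  obtain C where C: "C \<subseteq> K" "finite C" "K \<subseteq> (\<Union>t\<in>C. ball t (d t))"
    by (rule compactE_image[OF K(1), of K "\<lambda>t. ball t (d t)"]) (use d K(2) in force)+
  show ?thesis
  proof (rule that)
    fix t x assume "t \<in> K"
    then obtain c where c: "c \<in> C" "dist t c < d c" using C(3) by (auto simp: dist_commute)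
    then have "\<bar>u t x\<bar> \<le> B c" using B[of c t x] C(1) K(2) \<open>t \<in> K\<close> by auto
    also have "B c \<le> Max (B ` C)" using c(1) C(2) by simp
    finally show "\<bar>u t x\<bar> \<le> Max (B ` C)" .
  qed
qed

subsection \<open>Finite speed of propagation\<close>

text \<open>At a positive maximum \<open>(t', x')\<close> of \<open>exp (- (2 K + 1) t) f\<^sup>2\<close> over the trapezoid, with \<open>\<bar>c\<bar> \<le> K\<close>, this
  function strictly increases along the characteristic direction backwards in time. As \<open>\<bar>u\<bar> \<le> M\<close>, the
  segment in that direction stays in the trapezoid.\<close>

lemma transport_vanishes:
  fixes f f\<^sub>t f\<^sub>x u c :: "real \<Rightarrow> real \<Rightarrow> real"
  assumes cont_f: "continuous_on ({0..\<tau>} \<times> UNIV) (\<lambda>(t, x). f t x)"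
    and cont_fx: "continuous_on ({0..\<tau>} \<times> UNIV) (\<lambda>(t, x). f\<^sub>x t x)"
    and cont_c: "continuous_on ({0..\<tau>} \<times> UNIV) (\<lambda>(t, x). c t x)"
    and fx: "\<And>t x. t \<in> {0..\<tau>} \<Longrightarrow> (f t has_real_derivative f\<^sub>x t x) (at x)"
    and ft: "\<And>t x. t \<in> {0..\<tau>} \<Longrightarrow>
      ((\<lambda>t'. f t' x) has_real_derivative f\<^sub>t t x) (at t within {0..\<tau>})"
    and u: "\<And>t x. t \<in> {0..\<tau>} \<Longrightarrow> \<bar>u t x\<bar> \<le> M"
    and eq: "\<And>t x. t \<in> {0..\<tau>} \<Longrightarrow> A + M * t \<le> x \<Longrightarrow> x \<le> B - M * t \<Longrightarrow>
      f\<^sub>t t x + u t x * f\<^sub>x t x = c t x * f t x"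
    and init: "\<And>x. A \<le> x \<Longrightarrow> x \<le> B \<Longrightarrow> f 0 x = 0"
    and t: "t \<in> {0..\<tau>}" and x: "A + M * t \<le> x" "x \<le> B - M * t"
  shows "f t x = 0"
proof (rule ccontr)
  assume nz: "f t x \<noteq> 0"
  define D where "D = {p \<in> {0..\<tau>} \<times> (UNIV :: real set). A + M * fst p \<le> snd p \<and> snd p \<le> B - M * fst p}"
  \<comment> \<open>The trapezoid therefore does not widen with time, so it lies over its base
    \<open>{A..B}\<close> and is compact.\<close>
  have "M \<ge> 0" using u[OF t, of 0] by linarith
  have D_sub: "D \<subseteq> {0..\<tau>} \<times> {A..B}"
    using \<open>M \<ge> 0\<close> by (auto simp: D_def) (smt (verit) mult_nonneg_nonneg)+
  have "closed D"
  proof -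
    have "closed {p :: real \<times> real. A + M * fst p \<le> snd p \<and> snd p \<le> B - M * fst p}"
      by (intro closed_Collect_conj closed_Collect_le continuous_intros)
    moreover have "D = ({0..\<tau>} \<times> UNIV) \<inter> {p. A + M * fst p \<le> snd p \<and> snd p \<le> B - M * fst p}"
      by (auto simp: D_def)
    ultimately show ?thesis by (simp add: closed_Int closed_Times)
  qed
  then have "compact D"
    using compact_Int_closed[of "{0..\<tau>} \<times> {A..B}" D] D_sub by (simp add: compact_Times Int_absorb1)
  have D_strip: "D \<subseteq> {0..\<tau>} \<times> UNIV" by (auto simp: D_def)
  obtain K where K: "\<And>p. p \<in> D \<Longrightarrow> \<bar>c (fst p) (snd p)\<bar> \<le> K"
  proof -
    have "compact ((\<lambda>(t, x). c t x) ` D)"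
      by (rule compact_continuous_image[OF continuous_on_subset[OF cont_c D_strip] \<open>compact D\<close>])
    then obtain K where "\<forall>y\<in>(\<lambda>(t, x). c t x) ` D. norm y \<le> K"
      using compact_imp_bounded bounded_iff by metis
    then show ?thesis by (intro that[of K]) (auto simp: case_prod_unfold)
  qed
  \<comment> \<open>Along characteristics \<open>f\<^sup>2\<close> grows at rate
    \<open>2 * c\<close>, which is at most \<open>2 * K\<close>; the extra 1 makes the monotonicity
    strict.\<close>
  define w where "w p = exp (- (2 * K + 1) * fst p) * (f (fst p) (snd p))\<^sup>2" for p
  have "continuous_on D w"
    unfolding w_def using continuous_on_subset[OF cont_f D_strip]
    by (auto simp: case_prod_unfold intro!: continuous_intros)
  moreover have "(t, x) \<in> D" using t x by (simp add: D_def)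
  ultimately obtain p where p: "p \<in> D" and max: "\<And>q. q \<in> D \<Longrightarrow> w q \<le> w p"
    using continuous_attains_sup[OF \<open>compact D\<close>] by (metis empty_iff)
  obtain t' x' where p_eq: "p = (t', x')" by (cases p)
  have "0 < w (t, x)" using nz by (simp add: w_def)
  with max[OF \<open>(t, x) \<in> D\<close>] have "0 < w p" by linarith
  then have nz': "f t' x' \<noteq> 0" by (auto simp: w_def p_eq)
  have t': "t' \<in> {0..\<tau>}" and x': "A + M * t' \<le> x'" "x' \<le> B - M * t'"
    using p by (auto simp: D_def p_eq)
  \<comment> \<open>The initial condition excludes a maximum at time 0, which leaves room to go
    backwards.\<close>
  have "t' \<noteq> 0" using nz' init x' by auto
  then have "t' > 0" using t' by auto
  define v where "v = u t' x'"
  have v: "\<bar>v\<bar> \<le> M" using u[OF t'] by (simp add: v_def)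
  \<comment> \<open>Going back by \<open>h\<close> widens the trapezoid by \<open>h * M\<close> on
    each side, and the position moves by at most that much.\<close>
  have path: "(t' - h, x' - h * v) \<in> D" if "h \<in> {0..t'}" for h
  proof -
    have "h * v \<le> h * M" "- (h * v) \<le> h * M"
      using that v mult_left_mono[of v M h] mult_left_mono[of "-v" M h] by auto
    then show ?thesis using that t' x' by (auto simp: D_def algebra_simps)
  qed
  \<comment> \<open>Joint differentiability from the two partial derivatives, using continuity of
    the one in \<open>x\<close>; this criterion expects \<open>f\<^sub>x\<close> as a bounded linear
    map.\<close>
  have "((\<lambda>(x, y). f x y) has_derivative (\<lambda>(tx, ty). f\<^sub>t t' x' * tx + blinfun_scaleR_left (f\<^sub>x t' x') ty))
      (at (t', x') within {0..\<tau>} \<times> UNIV)"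
  proof (rule has_derivative_partialsI[where fy = "\<lambda>t x. blinfun_scaleR_left (f\<^sub>x t x)"])
    show "((\<lambda>s. f s x') has_derivative (*) (f\<^sub>t t' x')) (at t' within {0..\<tau>})"
      using ft[OF t'] by (simp add: has_field_derivative_def)
    show "((\<lambda>y. f s y) has_derivative blinfun_apply (blinfun_scaleR_left (f\<^sub>x s y))) (at y within UNIV)"
      if "s \<in> {0..\<tau>}" for s y
      using fx[OF that, of y] by (simp add: has_field_derivative_def blinfun_scaleR_left.rep_eq mult_commute_abs)
    show "continuous (at (t', x') within {0..\<tau>} \<times> UNIV) (\<lambda>(s, y). blinfun_scaleR_left (f\<^sub>x s y))"
      using cont_fx t' by (auto simp: continuous_on_eq_continuous_within case_prod_unfold
          intro!: continuous_intros)
  qed auto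
  then have D_f: "((\<lambda>(x, y). f x y) has_derivative (\<lambda>(tx, ty). f\<^sub>t t' x' * tx + f\<^sub>x t' x' * ty))
      (at (t', x') within {0..\<tau>} \<times> UNIV)"
    by (simp add: mult.commute blinfun_scaleR_left.rep_eq)
  \<comment> \<open>The velocity is frozen at its value \<open>v\<close> at the maximum, so the path
    is a straight segment; the derivative of \<open>f\<close> along it at 0 is minus the left side
    of the transport equation.\<close>
  define \<phi> where "\<phi> h = w (t' - h, x' - h * v)" for h
  have "((\<lambda>h. (\<lambda>(x, y). f x y) (t' - h, x' - h * v)) has_derivative
      (\<lambda>h. (\<lambda>(tx, ty). f\<^sub>t t' x' * tx + f\<^sub>x t' x' * ty) (- h, - (h * v)))) (at 0 within {0..t'})"
  proof (rule has_derivative_in_compose[where g = "\<lambda>(x, y). f x y"])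
    show "((\<lambda>h. (t' - h, x' - h * v)) has_derivative (\<lambda>h. (- h, - (h * v)))) (at 0 within {0..t'})"
      by (auto intro!: derivative_eq_intros)
    show "((\<lambda>(x, y). f x y) has_derivative (\<lambda>(tx, ty). f\<^sub>t t' x' * tx + f\<^sub>x t' x' * ty))
        (at (t' - 0, x' - 0 * v) within (\<lambda>h. (t' - h, x' - h * v)) ` {0..t'})"
      using t' by (simp, intro has_derivative_subset[OF D_f]) auto
  qed
  then have "((\<lambda>h. f (t' - h) (x' - h * v)) has_real_derivative - (f\<^sub>t t' x' + v * f\<^sub>x t' x')) (at 0 within {0..t'})"
    unfolding has_field_derivative_def prod.case by (rule has_derivative_eq_rhs) (simp add: fun_eq_iff algebra_simps)
  then have f_path: "((\<lambda>h. f (t' - h) (x' - h * v)) has_real_derivative - (c t' x' * f t' x')) (at 0 within {0..t'})"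
    using eq[OF t' x'] by (simp add: v_def)
  define E where "E = exp (- (2 * K + 1) * t')"
  have "(\<phi> has_real_derivative E * (f t' x')\<^sup>2 * (2 * K + 1 - 2 * c t' x')) (at 0 within {0..t'})"
    unfolding \<phi>_def w_def E_def fst_conv snd_conv
    by (rule derivative_eq_intros f_path refl)+ (simp add: algebra_simps power2_eq_square)
  moreover have "0 < E * (f t' x')\<^sup>2 * (2 * K + 1 - 2 * c t' x')"
    using nz' K[OF p] by (intro mult_pos_pos) (auto simp: E_def p_eq abs_le_iff)
  ultimately obtain d where "d > 0" and inc: "\<And>h. 0 < h \<Longrightarrow> h \<in> {0..t'} \<Longrightarrow> h < d \<Longrightarrow> \<phi> 0 < \<phi> h"
    using has_real_derivative_pos_inc_right[of \<phi> _ 0 "{0..t'}"] by force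
  define h where "h = min t' (d / 2)"
  have h: "0 < h" "h \<in> {0..t'}" "h < d"
    using \<open>t' > 0\<close> \<open>d > 0\<close> by (auto simp: h_def min_def)
  have "\<phi> h \<le> \<phi> 0" using max[OF path[OF h(2)]] by (simp add: \<phi>_def p_eq)
  with inc[OF h] show False by simp
qed

section \<open>Supports, and the conclusion for the system\<close>

lemma zero_outside_support:
  assumes "x \<notin> support f"
  shows "f x = 0"
  using assms closure_subset[of "support_on UNIV f"] by (auto simp: support_def support_on_def)

text \<open>The complement of a support is open, so \<open>f\<close> is zero near \<open>x\<close>.
  This supplies the continuity of \<open>m0\<close> used to identify it with
  \<open>m 0\<close>.\<close>

lemma isCont_outside_support:
  assumes "x \<notin> support f"
  shows "isCont f x"
proof -
  have "open (- support f)" by (simp add: support_def open_Compl)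
  then have "eventually (\<lambda>y. y \<in> - support f) (nhds x)" using assms by (intro eventually_nhds_in_open) auto
  then have "eventually (\<lambda>y. f y = (\<lambda>_. 0) y) (nhds x)"
    by eventually_elim (simp add: zero_outside_support)
  then show ?thesis by (subst isCont_cong) auto
qed

theorem corollary3p2:
  fixes r b \<kappa> s \<beta>\<^sub>m \<gamma>\<^sub>m \<beta>\<^sub>\<rho> \<gamma>\<^sub>\<rho> :: real
    and u0 m0 \<rho>0 :: "real \<Rightarrow> real"
    and T :: ereal
    and u m \<rho> :: "real \<Rightarrow> real \<Rightarrow> real"
  assumes "r \<ge> 1" and "s > 2 * r + 1 / 2"
    and "u0 \<in> sobolev s" and "\<rho>0 \<in> sobolev (s - 2 * r + 1)"
    and "is_inertia r u0 m0"
    and "compact (support m0)" and "support m0 \<subseteq> {\<beta>\<^sub>m..\<gamma>\<^sub>m}"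
    and "compact (support \<rho>0)" and "support \<rho>0 \<subseteq> {\<beta>\<^sub>\<rho>..\<gamma>\<^sub>\<rho>}"
    and "maximal_classical_solution r b \<kappa> s u0 \<rho>0 T u m \<rho>"
  shows "\<forall>t\<in>time_interval T. compact (support (m t))"
proof
  fix \<tau> assume \<tau>: "\<tau> \<in> time_interval T"
  have sub: "{0..\<tau>} \<subseteq> time_interval T"
    using \<tau> by (auto simp: time_interval_def intro: le_less_trans[of _ "ereal \<tau>"])
  have "0 \<le> \<tau>" using \<tau> by (simp add: time_interval_def)
  then have zero: "0 \<in> time_interval T" using sub by auto
  have sol: "classical_solution r b \<kappa> s u0 \<rho>0 T u m \<rho>"
    using assms(10) by (simp add: maximal_classical_solution_def)
  then have sob: "sobolev_continuous_on s (time_interval T) u"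
    and inertia: "\<And>t. t \<in> time_interval T \<Longrightarrow> is_inertia r (u t) (m t)"
    and init: "\<And>x. u 0 x = u0 x" "\<And>x. \<rho> 0 x = \<rho>0 x"
    by (auto simp: classical_solution_def)
  obtain u\<^sub>x m\<^sub>t m\<^sub>x \<rho>\<^sub>t \<rho>\<^sub>x where
    cont: "\<forall>w\<in>{u, u\<^sub>x, m, m\<^sub>t, m\<^sub>x, \<rho>, \<rho>\<^sub>t, \<rho>\<^sub>x}. continuous_on (time_interval T \<times> UNIV) (\<lambda>(t, x). w t x)"
    and eqs: "\<forall>t\<in>time_interval T. \<forall>x.
           (u t has_real_derivative u\<^sub>x t x) (at x) \<and>
           (m t has_real_derivative m\<^sub>x t x) (at x) \<and>
           (\<rho> t has_real_derivative \<rho>\<^sub>x t x) (at x) \<and>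
           ((\<lambda>\<tau>. m \<tau> x) has_real_derivative m\<^sub>t t x) (at t within time_interval T) \<and>
           ((\<lambda>\<tau>. \<rho> \<tau> x) has_real_derivative \<rho>\<^sub>t t x) (at t within time_interval T) \<and>
           m\<^sub>t t x = - b * u\<^sub>x t x * m t x - u t x * m\<^sub>x t x - \<kappa> * \<rho> t x * \<rho>\<^sub>x t x \<and>
           \<rho>\<^sub>t t x = - u t x * \<rho>\<^sub>x t x - (b - 1) * u\<^sub>x t x * \<rho> t x"
    using sol unfolding classical_solution_def by (elim conjE exE) blast
  have cont': "continuous_on ({0..\<tau>} \<times> UNIV) (\<lambda>(t, x). w t x)" if "w \<in> {u\<^sub>x, m, m\<^sub>x, \<rho>, \<rho>\<^sub>x}" for w
    using cont that sub by (intro continuous_on_subset[of "time_interval T \<times> UNIV" _ "{0..\<tau>} \<times> UNIV"]) auto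
  have cont_c: "continuous_on ({0..\<tau>} \<times> UNIV) (\<lambda>(t, x). a * u\<^sub>x t x)" for a
    using continuous_on_mult_left[OF cont'[of u\<^sub>x], of a] by (simp add: case_prod_unfold)
  have deriv: "(m t has_real_derivative m\<^sub>x t x) (at x)" "(\<rho> t has_real_derivative \<rho>\<^sub>x t x) (at x)"
      "((\<lambda>t. m t x) has_real_derivative m\<^sub>t t x) (at t within {0..\<tau>})"
      "((\<lambda>t. \<rho> t x) has_real_derivative \<rho>\<^sub>t t x) (at t within {0..\<tau>})"
    if "t \<in> {0..\<tau>}" for t x
    using eqs that sub by (blast intro: has_field_derivative_subset[OF _ sub])+
  have pde: "m\<^sub>t t x = - b * u\<^sub>x t x * m t x - u t x * m\<^sub>x t x - \<kappa> * \<rho> t x * \<rho>\<^sub>x t x"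
      "\<rho>\<^sub>t t x = - u t x * \<rho>\<^sub>x t x - (b - 1) * u\<^sub>x t x * \<rho> t x"
    if "t \<in> {0..\<tau>}" for t x
    using eqs that sub by blast+
  \<comment> \<open>The hypotheses on \<open>r\<close> and \<open>s\<close> give
    \<open>s > 5 / 2\<close>, well above the threshold 1 of the sup bound.\<close>
  obtain M where M: "\<And>t x. t \<in> {0..\<tau>} \<Longrightarrow> \<bar>u t x\<bar> \<le> M"
    by (rule sobolev_continuous_on_bounded[OF _ sob _ _ sub])
       (use assms(1,2) eqs in \<open>auto intro: DERIV_isCont\<close>)
  \<comment> \<open>Both \<open>m 0\<close> and \<open>m0\<close> are continuous outside the support
    of \<open>m0\<close>, so there the equality almost everywhere becomes pointwise.\<close>
  have m0: "m 0 x = 0" if "x \<notin> {\<beta>\<^sub>m..\<gamma>\<^sub>m}" for x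
  proof -
    have x: "x \<notin> support m0" using that assms(7) by auto
    have "isCont (m 0) x" using eqs zero by (blast intro: DERIV_isCont)
    moreover have "u 0 = u0" using init by auto
    ultimately have "m 0 x = m0 x"
      using is_inertia_unique[of r u0 "m 0" m0 x] inertia[OF zero] assms(5) isCont_outside_support[OF x] by simp
    then show ?thesis using zero_outside_support[OF x] by simp
  qed
  have \<rho>0: "\<rho> 0 x = 0" if "x \<notin> {\<beta>\<^sub>\<rho>..\<gamma>\<^sub>\<rho>}" for x
    using zero_outside_support[of x \<rho>0] assms(9) that by (auto simp only: init(2))
  \<comment> \<open>The interval from \<beta> to \<gamma> covers both given intervals, since
    \<open>m\<close> is controlled only where \<rho> vanishes as well.\<close>
  define \<beta> where "\<beta> = min \<beta>\<^sub>m \<beta>\<^sub>\<rho>"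
  define \<gamma> where "\<gamma> = max \<gamma>\<^sub>m \<gamma>\<^sub>\<rho>"
  \<comment> \<open>Both initial data vanish on the base \<open>{A..B}\<close>, which lies to the
    left of \<beta> or to the right of \<gamma>.\<close>
  have m_zero: "m \<tau> x = 0" if AB: "B < \<beta> \<or> \<gamma> < A" and x: "A + M * \<tau> \<le> x" "x \<le> B - M * \<tau>" for A B x
  proof -
    have out: "y \<notin> {\<beta>\<^sub>m..\<gamma>\<^sub>m}" "y \<notin> {\<beta>\<^sub>\<rho>..\<gamma>\<^sub>\<rho>}" if "A \<le> y" "y \<le> B" for y
      using AB that by (auto simp: \<beta>_def \<gamma>_def)
    have \<rho>_zero: "\<rho> t y = 0" if "t \<in> {0..\<tau>}" "A + M * t \<le> y" "y \<le> B - M * t" for t y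
    proof (rule transport_vanishes[where f = \<rho> and f\<^sub>t = \<rho>\<^sub>t and f\<^sub>x = \<rho>\<^sub>x and u = u and c = "\<lambda>t x. (1 - b) * u\<^sub>x t x"
          and \<tau> = \<tau> and A = A and B = B and M = M])
      show "\<rho>\<^sub>t t x + u t x * \<rho>\<^sub>x t x = (1 - b) * u\<^sub>x t x * \<rho> t x" if "t \<in> {0..\<tau>}" for t x
        using pde(2)[OF that, of x] by (simp add: left_diff_distrib)
    qed (use that cont' cont_c deriv M \<rho>0 out in auto)
    show ?thesis
    proof (rule transport_vanishes[where f = m and f\<^sub>t = m\<^sub>t and f\<^sub>x = m\<^sub>x and u = u and c = "\<lambda>t x. - b * u\<^sub>x t x"
          and \<tau> = \<tau> and A = A and B = B and M = M])
      \<comment> \<open>As \<rho> is zero on the whole trapezoid, the source term with \<kappa>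
        drops out and the equation for \<open>m\<close> is homogeneous there.\<close>
      show "m\<^sub>t t y + u t y * m\<^sub>x t y = - b * u\<^sub>x t y * m t y"
        if "t \<in> {0..\<tau>}" "A + M * t \<le> y" "y \<le> B - M * t" for t y
        using pde(1)[OF that(1), of y] \<rho>_zero[OF that] by simp
    qed (use x cont' cont_c[of "- b"] deriv M m0 out \<open>0 \<le> \<tau>\<close> in auto)
  qed
  \<comment> \<open>The margin 1 keeps the bases strictly away from \<beta> and \<gamma>.\<close>
  have "m \<tau> x = 0" if "x \<notin> {\<beta> - 1 - M * \<tau>..\<gamma> + 1 + M * \<tau>}" for x
  proof (cases "x < \<beta> - 1 - M * \<tau>")
    case True
    \<comment> \<open>The instances are \<open>B\<close> and \<open>A\<close>, in this order:
      \<open>x\<close> is the left end of the trapezoid at time \<tau>. The other case is its mirror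
      image.\<close>
    then show ?thesis by (intro m_zero[of "\<beta> - 1" "x - M * \<tau>"]) auto
  next
    case False
    then show ?thesis using that by (intro m_zero[of "x + M * \<tau>" "\<gamma> + 1"]) auto
  qed
  then have "support_on UNIV (m \<tau>) \<subseteq> {\<beta> - 1 - M * \<tau>..\<gamma> + 1 + M * \<tau>}"
    unfolding support_on_def by blast
  then have "support (m \<tau>) \<subseteq> {\<beta> - 1 - M * \<tau>..\<gamma> + 1 + M * \<tau>}"
    unfolding support_def by (intro closure_minimal) auto
  moreover have "closed (support (m \<tau>))" by (simp add: support_def)
  ultimately show "compact (support (m \<tau>))"
    by (meson bounded_subset bounded_closed_interval compact_eq_bounded_closed)
qed

end
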